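(* Let $\mathrm{M}=\langle e_1+I,\ e_2+I\rangle$ and $\Lambda=\langle e_1+I,\ e_1/2+\sqrt3 e_2/2+I\rangle$, where $e_1,e_2$ are the standard basis vectors of $E^2$. Let $\mathrm{K}=\{(a+I)_\star : a\in E^2\}\subseteq \mathrm{Aff}(\mathrm{M})$ and let $$A=\begin{pmatrix}-1&0\\0&1\end{pmatrix},\ B=\begin{pmatrix}-1&1\\0&1\end{pmatrix},\ C=\begin{pmatrix}0&1\\1&0\end{pmatrix},\ D=\begin{pmatrix}1&-1/2\\0&\sqrt3/2\end{pmatrix}.$$ Then $\mathrm{Sym}(\mathrm{M})=\langle \mathrm{K}, A_\star, C_\star\rangle$, $D\mathrm{M}D^{-1}=\Lambda$, the map $D_\sharp:\mathrm{Aff}(\mathrm{M})\to\mathrm{Aff}(\Lambda)$ is an isomorphism, and $\mathrm{Sym}(\Lambda)=D_\sharp(\langle \mathrm{K}, B_\star, C_\star\rangle)$.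
   Context: Affine maps of $E^2$ are written $a+A$ (meaning $x\mapsto a+Ax$); $a+I$ is translation by $a$. For a 2-space group $\mathrm{M}$ (a discrete group of isometries of $E^2$ with compact quotient), let $N_A(\mathrm{M})$ be its normalizer in the affine group of $E^2$. Each $a+A\in N_A(\mathrm{M})$ induces an affinity $(a+A)_\star:\mathrm{M}x\mapsto\mathrm{M}(a+Ax)$ of the flat orbifold $E^2/\mathrm{M}$; $\mathrm{Aff}(\mathrm{M})$ is the group of all such affinities, and $\mathrm{Sym}(\mathrm{M})=\mathrm{Isom}(E^2/\mathrm{M})$ is its subgroup of isometries of the flat orbifold $E^2/\mathrm{M}$. For an affine map $\phi$ with $\phi\mathrm{M}\phi^{-1}=\Lambda$, $\phi_\sharp:\mathrm{Aff}(\mathrm{M})\to\mathrm{Aff}(\Lambda)$ is defined by $\phi_\sharp((a+A)_\star)=(\phi(a+A)\phi^{-1})_\star$. Here $E^2/\mathrm{M}$ is the square torus and $E^2/\Lambda$ the hexagonal torus. *)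

theory Defs
  imports "HOL-Analysis.Analysis" "HOL-Algebra.Generated_Groups"
begin

text \<open>Affine maps a + A of the Euclidean plane, represented as pairs (a, A).\<close>
type_synonym affmap = "(real^2) \<times> (real^2^2)"

definition aff_apply :: "affmap \<Rightarrow> real^2 \<Rightarrow> real^2" where
  "aff_apply \<phi> x = fst \<phi> + snd \<phi> *v x"

definition aff_comp :: "affmap \<Rightarrow> affmap \<Rightarrow> affmap" where
  "aff_comp \<phi> \<psi> = (fst \<phi> + snd \<phi> *v fst \<psi>, snd \<phi> ** snd \<psi>)"

definition aff_inv :: "affmap \<Rightarrow> affmap" where
  "aff_inv \<phi> = (- (matrix_inv (snd \<phi>) *v fst \<phi>), matrix_inv (snd \<phi>))"

text \<open>The affine group of the plane as a HOL-Algebra group structure.\<close>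
definition AffGroup :: "affmap monoid" where
  "AffGroup = \<lparr>carrier = {\<phi>. invertible (snd \<phi>)}, mult = aff_comp, one = (0, mat 1)\<rparr>"

definition transl :: "real^2 \<Rightarrow> affmap" where
  "transl a = (a, mat 1)"

definition linmap :: "real^2^2 \<Rightarrow> affmap" where
  "linmap A = (0, A)"

text \<open>Conjugate of a group of affine maps: phi G phi^-1.\<close>
definition conj_set :: "affmap \<Rightarrow> affmap set \<Rightarrow> affmap set" where
  "conj_set \<phi> G = (\<lambda>g. aff_comp (aff_comp \<phi> g) (aff_inv \<phi>)) ` G"

text \<open>Normalizer N_A(G) in the affine group.\<close>
definition aff_normalizer :: "affmap set \<Rightarrow> affmap set" where
  "aff_normalizer G = {\<phi> \<in> carrier AffGroup. conj_set \<phi> G = G}"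

definition orbit :: "affmap set \<Rightarrow> real^2 \<Rightarrow> (real^2) set" where
  "orbit G x = {aff_apply g x | g. g \<in> G}"

text \<open>The orbit space E^2/G.\<close>
definition orbspace :: "affmap set \<Rightarrow> (real^2) set set" where
  "orbspace G = range (orbit G)"

text \<open>The induced map (phi)_star : G x \<mapsto> G (phi x) on E^2/G.\<close>
definition induced :: "affmap set \<Rightarrow> affmap \<Rightarrow> (real^2) set \<Rightarrow> (real^2) set" where
  "induced G \<phi> = restrict (\<lambda>S. orbit G (aff_apply \<phi> (SOME x. x \<in> S))) (orbspace G)"

text \<open>Aff(G): all affinities of E^2/G induced by elements of N_A(G).\<close>
definition Aff :: "affmap set \<Rightarrow> ((real^2) set \<Rightarrow> (real^2) set) set" where
  "Aff G = induced G ` aff_normalizer G"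

text \<open>Aff(G) as a group under composition of maps of E^2/G.\<close>
definition AffOrb :: "affmap set \<Rightarrow> ((real^2) set \<Rightarrow> (real^2) set) monoid" where
  "AffOrb G = \<lparr>carrier = Aff G, mult = compose (orbspace G),
               one = restrict id (orbspace G)\<rparr>"

text \<open>Quotient (orbifold) metric on E^2/G.\<close>
definition orb_dist :: "(real^2) set \<Rightarrow> (real^2) set \<Rightarrow> real" where
  "orb_dist O1 O2 = Inf {dist x y | x y. x \<in> O1 \<and> y \<in> O2}"

text \<open>Sym(G) = Isom(E^2/G): the affinities that are isometries of E^2/G.\<close>
definition Sym :: "affmap set \<Rightarrow> ((real^2) set \<Rightarrow> (real^2) set) set" where
  "Sym G = {f \<in> Aff G. \<forall>O1 \<in> orbspace G. \<forall>O2 \<in> orbspace G.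
                orb_dist (f O1) (f O2) = orb_dist O1 O2}"

text \<open>phi_sharp : Aff(G) \<rightarrow> Aff(H), (a+A)_star \<mapsto> (phi (a+A) phi^-1)_star.\<close>
definition sharp :: "affmap \<Rightarrow> affmap set \<Rightarrow> affmap set
    \<Rightarrow> ((real^2) set \<Rightarrow> (real^2) set) \<Rightarrow> ((real^2) set \<Rightarrow> (real^2) set)" where
  "sharp \<phi> G H f = induced H (aff_comp (aff_comp \<phi> (SOME \<psi>. \<psi> \<in> aff_normalizer G \<and> induced G \<psi> = f))
                                 (aff_inv \<phi>))"

definition e1 :: "real^2" where "e1 = vector [1, 0]"
definition e2 :: "real^2" where "e2 = vector [0, 1]"

definition Mgrp :: "affmap set" where
  "Mgrp = generate AffGroup {transl e1, transl e2}"

definition Lgrp :: "affmap set" where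
  "Lgrp = generate AffGroup {transl e1, transl ((1/2) *\<^sub>R e1 + (sqrt 3 / 2) *\<^sub>R e2)}"

definition Amat :: "real^2^2" where "Amat = vector [vector [-1, 0], vector [0, 1]]"
definition Bmat :: "real^2^2" where "Bmat = vector [vector [-1, 1], vector [0, 1]]"
definition Cmat :: "real^2^2" where "Cmat = vector [vector [0, 1], vector [1, 0]]"
definition Dmat :: "real^2^2" where "Dmat = vector [vector [1, -1/2], vector [0, sqrt 3 / 2]]"

definition Kgrp :: "((real^2) set \<Rightarrow> (real^2) set) set" where
  "Kgrp = {induced Mgrp (transl a) | a. True}"

end

theory Submission
  imports Defs
begin

text \<open>
  Both groups are translation groups of lattices: \<open>M\<close> of the square lattice \<open>\<int>\<^sup>2\<close> and
  \<open>\<Lambda>\<close> of the hexagonal lattice \<open>D \<int>\<^sup>2\<close>. For the translation group of a lattice \<open>L\<close>, an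
  affine map normalizes it iff its linear part preserves \<open>L\<close>, two such maps induce the same
  affinity iff they differ by an \<open>L\<close>-valued function, and the orbifold distance between the
  orbits of \<open>x\<close> and \<open>y\<close> is the distance from \<open>x - y\<close> to \<open>L\<close>. As this distance is the norm
  for short vectors, an induced affinity is an isometry iff its linear part is orthogonal.
  Conjugation by \<open>D\<close> carries \<open>\<int>\<^sup>2\<close> onto the hexagonal lattice, so \<open>D\<^sub>\<sharp>\<close> is an isomorphism
  mapping the affinities whose linear part \<open>X\<close> makes \<open>D X D\<^sup>-\<^sup>1\<close> orthogonal onto
  \<open>Sym(\<Lambda>)\<close>. Finally an integral matrix preserving \<open>x\<^sup>2 + y\<^sup>2\<close> (resp. \<open>x\<^sup>2 - x y + y\<^sup>2\<close>)
  has entries in \<open>{-1, 0, 1}\<close>, which leaves 8 (resp. 12) matrices, each a word in \<open>A, C\<close>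
  (resp. \<open>B, C\<close>); together with the translations these words generate the symmetries.
\<close>

section \<open>Matrix inverses and the affine group\<close>

lemma matrix_inv_right:
  fixes A :: "real^'n^'n"
  shows "invertible A \<Longrightarrow> A ** matrix_inv A = mat 1"
  unfolding matrix_inv_def invertible_def by (rule someI_ex[THEN conjunct1])

lemma matrix_inv_left:
  fixes A :: "real^'n^'n"
  shows "invertible A \<Longrightarrow> matrix_inv A ** A = mat 1"
  unfolding matrix_inv_def invertible_def by (rule someI_ex[THEN conjunct2])

lemma matrix_inv_unique:
  fixes A B :: "real^'n^'n"
  assumes "A ** B = mat 1"
  shows "matrix_inv A = B"
proof -
  have "invertible A"
    using assms invertible_right_inverse by blast
  then have "matrix_inv A = matrix_inv A ** (A ** B)"
    using assms by simp
  also have "\<dots> = B"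
    by (simp add: matrix_mul_assoc matrix_inv_left \<open>invertible A\<close>)
  finally show ?thesis .
qed

lemma invertible_matrix_inv:
  fixes A :: "real^'n^'n"
  shows "invertible A \<Longrightarrow> invertible (matrix_inv A)"
  using matrix_inv_left invertible_right_inverse by blast

lemma matrix_inv_mult_vector [simp]:
  fixes A :: "real^'n^'n"
  assumes "invertible A"
  shows "matrix_inv A *v (A *v v) = v" "A *v (matrix_inv A *v v) = v"
  by (simp_all add: matrix_vector_mul_assoc matrix_inv_left matrix_inv_right assms)

lemma aff_comp_assoc: "aff_comp (aff_comp f g) h = aff_comp f (aff_comp g h)"
  by (simp add: aff_comp_def matrix_vector_right_distrib matrix_vector_mul_assoc
      matrix_mul_assoc add.assoc)

lemma aff_apply_comp: "aff_apply (aff_comp f g) x = aff_apply f (aff_apply g x)"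
  by (simp add: aff_comp_def aff_apply_def matrix_vector_right_distrib matrix_vector_mul_assoc
      add.assoc)

lemma snd_aff_inv [simp]: "snd (aff_inv g) = matrix_inv (snd g)"
  by (simp add: aff_inv_def)

lemma aff_comp_inv_left: "invertible (snd g) \<Longrightarrow> aff_comp (aff_inv g) g = (0, mat 1)"
  by (simp add: aff_comp_def aff_inv_def matrix_inv_left)

lemma invertible_mat_1: "invertible (mat 1 :: real^'n^'n)"
  unfolding invertible_def by auto

lemma group_AffGroup: "group AffGroup"
proof (rule groupI)
  fix g assume "g \<in> carrier AffGroup"
  then have "aff_inv g \<in> carrier AffGroup \<and> aff_inv g \<otimes>\<^bsub>AffGroup\<^esub> g = \<one>\<^bsub>AffGroup\<^esub>"
    by (simp add: AffGroup_def invertible_matrix_inv aff_comp_inv_left)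
  then show "\<exists>h\<in>carrier AffGroup. h \<otimes>\<^bsub>AffGroup\<^esub> g = \<one>\<^bsub>AffGroup\<^esub>" by blast
qed (simp_all add: AffGroup_def aff_comp_assoc invertible_mat_1,
     simp_all add: aff_comp_def invertible_mult)

lemma inv_AffGroup: "g \<in> carrier AffGroup \<Longrightarrow> inv\<^bsub>AffGroup\<^esub> g = aff_inv g"
  by (rule group.inv_equality[OF group_AffGroup])
    (auto simp: AffGroup_def invertible_matrix_inv aff_comp_inv_left)

lemma transl_in_AffGroup: "transl a \<in> carrier AffGroup"
  by (auto simp: AffGroup_def transl_def invertible_mat_1)

lemma aff_inv_transl: "aff_inv (transl a) = transl (- a)"
  by (simp add: aff_inv_def transl_def matrix_inv_unique)

lemma inv_AffGroup_transl: "inv\<^bsub>AffGroup\<^esub> transl a = transl (- a)"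
  by (simp add: inv_AffGroup[OF transl_in_AffGroup] aff_inv_transl)

lemma aff_comp_transl: "aff_comp (transl a) (transl b) = transl (a + b)"
  by (simp add: aff_comp_def transl_def)

section \<open>Translation groups of lattices\<close>

definition add_subgroup :: "'a::ab_group_add set \<Rightarrow> bool" where
  "add_subgroup L \<longleftrightarrow> 0 \<in> L \<and> (\<forall>x\<in>L. \<forall>y\<in>L. x - y \<in> L)"

lemma add_subgroupD:
  assumes "add_subgroup L"
  shows add_subgroup_zero: "0 \<in> L"
    and add_subgroup_diff: "x \<in> L \<Longrightarrow> y \<in> L \<Longrightarrow> x - y \<in> L"
    and add_subgroup_minus: "x \<in> L \<Longrightarrow> - x \<in> L"
    and add_subgroup_add: "x \<in> L \<Longrightarrow> y \<in> L \<Longrightarrow> x + y \<in> L"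
  using assms unfolding add_subgroup_def by (metis diff_0 diff_minus_eq_add)+

lemma add_subgroup_of_int_scaleR:
  fixes u :: "'a::real_vector"
  assumes L: "add_subgroup L" and u: "u \<in> L"
  shows "of_int k *\<^sub>R u \<in> L"
proof (induction k rule: int_induct[where k = 0])
  case base
  show ?case using add_subgroup_zero[OF L] by simp
next
  case (step1 i)
  have "of_int (i + 1) *\<^sub>R u = of_int i *\<^sub>R u + u"
    by (simp add: algebra_simps)
  then show ?case using add_subgroup_add[OF L step1(2) u] by simp
next
  case (step2 i)
  then show ?case using add_subgroup_diff[OF L _ u] by (simp add: algebra_simps)
qed

definition int_lattice :: "'a::real_vector \<Rightarrow> 'a \<Rightarrow> 'a set" where
  "int_lattice u v = {of_int m *\<^sub>R u + of_int n *\<^sub>R v | m n. True}"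

lemma add_subgroup_int_lattice: "add_subgroup (int_lattice u v)"
proof -
  have "of_int m *\<^sub>R u + of_int n *\<^sub>R v - (of_int m' *\<^sub>R u + of_int n' *\<^sub>R v)
      = of_int (m - m') *\<^sub>R u + of_int (n - n') *\<^sub>R v" for m n m' n' :: int
    by (simp add: algebra_simps)
  moreover have "0 = of_int 0 *\<^sub>R u + of_int 0 *\<^sub>R v"
    by simp
  ultimately show ?thesis
    unfolding add_subgroup_def int_lattice_def by blast
qed

lemma generators_in_int_lattice: "u \<in> int_lattice u v" "v \<in> int_lattice u v"
proof -
  have "u = of_int 1 *\<^sub>R u + of_int 0 *\<^sub>R v" "v = of_int 0 *\<^sub>R u + of_int 1 *\<^sub>R v"
    by simp_all
  then show "u \<in> int_lattice u v" "v \<in> int_lattice u v"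
    unfolding int_lattice_def by blast+
qed

lemma int_lattice_least:
  "add_subgroup L \<Longrightarrow> u \<in> L \<Longrightarrow> v \<in> L \<Longrightarrow> int_lattice u v \<subseteq> L"
  unfolding int_lattice_def by (auto intro: add_subgroup_add add_subgroup_of_int_scaleR)

definition transl_group :: "(real^2) set \<Rightarrow> affmap set" where
  "transl_group L = transl ` L"

lemma subgroup_transl_group:
  assumes "add_subgroup L"
  shows "subgroup (transl_group L) AffGroup"
proof (rule group.subgroupI[OF group_AffGroup])
  show "transl_group L \<subseteq> carrier AffGroup" "transl_group L \<noteq> {}"
    using transl_in_AffGroup add_subgroup_zero[OF assms] by (auto simp: transl_group_def)
  show "g \<in> transl_group L \<Longrightarrow> inv\<^bsub>AffGroup\<^esub> g \<in> transl_group L" for g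
    using add_subgroup_minus[OF assms] by (auto simp: transl_group_def inv_AffGroup_transl)
  show "g \<in> transl_group L \<Longrightarrow> h \<in> transl_group L \<Longrightarrow> g \<otimes>\<^bsub>AffGroup\<^esub> h \<in> transl_group L" for g h
    using add_subgroup_add[OF assms] by (auto simp: transl_group_def AffGroup_def aff_comp_transl)
qed

lemma generate_transl_pair:
  "generate AffGroup {transl u, transl v} = transl_group (int_lattice u v)"
proof
  show "generate AffGroup {transl u, transl v} \<subseteq> transl_group (int_lattice u v)"
    by (intro group.generate_subgroup_incl[OF group_AffGroup]
        subgroup_transl_group[OF add_subgroup_int_lattice])
      (simp add: transl_group_def imageI generators_in_int_lattice)
next
  let ?G = "generate AffGroup {transl u, transl v}"
  have sub: "subgroup ?G AffGroup"
    by (rule group.generate_is_subgroup[OF group_AffGroup]) (simp add: transl_in_AffGroup)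
  have "transl (x - y) = transl x \<otimes>\<^bsub>AffGroup\<^esub> inv\<^bsub>AffGroup\<^esub> transl y" for x y
    by (simp add: inv_AffGroup_transl, simp add: AffGroup_def aff_comp_transl)
  then have "add_subgroup {a. transl a \<in> ?G}"
    using subgroup.one_closed[OF sub] subgroup.m_closed[OF sub] subgroup.m_inv_closed[OF sub]
    by (simp add: add_subgroup_def AffGroup_def transl_def)
  moreover have "transl u \<in> ?G" "transl v \<in> ?G"
    by (simp_all add: generate.incl)
  ultimately have "int_lattice u v \<subseteq> {a. transl a \<in> ?G}"
    by (intro int_lattice_least) simp_all
  then show "transl_group (int_lattice u v) \<subseteq> ?G"
    unfolding transl_group_def by blast
qed

definition lattice_normalizer :: "(real^2) set \<Rightarrow> affmap set" where
  "lattice_normalizer L = {\<phi>. invertible (snd \<phi>) \<and> (*v) (snd \<phi>) ` L = L}"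

lemma conj_transl:
  assumes "invertible (snd g)"
  shows "aff_comp (aff_comp g (transl l)) (aff_inv g) = transl (snd g *v l)"
proof -
  have "snd g *v (- (matrix_inv (snd g) *v fst g)) = - fst g"
    using matrix_vector_mult_diff_distrib[of "snd g" 0] assms by simp
  then show ?thesis
    using assms
    by (simp add: aff_comp_def aff_inv_def transl_def matrix_vector_right_distrib matrix_inv_right)
qed

lemma conj_set_transl_group:
  "invertible (snd g) \<Longrightarrow> conj_set g (transl_group L) = transl_group ((*v) (snd g) ` L)"
  unfolding conj_set_def transl_group_def image_image by (simp add: conj_transl)

lemma transl_group_eq_iff: "transl_group L = transl_group L' \<longleftrightarrow> L = L'"
proof -
  have "inj transl"
    by (simp add: inj_def transl_def)
  then show ?thesis
    by (simp add: transl_group_def inj_image_eq_iff)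
qed

lemma aff_normalizer_transl_group: "aff_normalizer (transl_group L) = lattice_normalizer L"
  by (auto simp: aff_normalizer_def lattice_normalizer_def AffGroup_def conj_set_transl_group
      transl_group_eq_iff) blast

lemma lattice_normalizer_comp:
  assumes "\<phi> \<in> lattice_normalizer L" "\<psi> \<in> lattice_normalizer L"
  shows "aff_comp \<phi> \<psi> \<in> lattice_normalizer L"
proof -
  have "(*v) (snd \<phi> ** snd \<psi>) ` L = (*v) (snd \<phi>) ` (*v) (snd \<psi>) ` L"
    by (simp add: image_image matrix_vector_mul_assoc)
  then show ?thesis
    using assms by (simp add: lattice_normalizer_def aff_comp_def invertible_mult)
qed

lemma lattice_normalizer_inv:
  assumes "\<phi> \<in> lattice_normalizer L"
  shows "aff_inv \<phi> \<in> lattice_normalizer L"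
proof -
  have inv: "invertible (snd \<phi>)" and L: "(*v) (snd \<phi>) ` L = L"
    using assms by (auto simp: lattice_normalizer_def)
  have "(*v) (matrix_inv (snd \<phi>)) ` L = (*v) (matrix_inv (snd \<phi>)) ` (*v) (snd \<phi>) ` L"
    by (simp add: L)
  also have "\<dots> = L"
    by (simp add: image_image inv)
  finally show ?thesis
    by (simp add: lattice_normalizer_def inv invertible_matrix_inv)
qed

lemma lattice_normalizer_one: "(0, mat 1) \<in> lattice_normalizer L"
  by (simp add: lattice_normalizer_def invertible_mat_1)

lemma transl_in_lattice_normalizer: "transl a \<in> lattice_normalizer L"
  by (simp add: lattice_normalizer_def transl_def invertible_mat_1)

lemma mem_orbit_transl_group: "y \<in> orbit (transl_group L) x \<longleftrightarrow> y - x \<in> L"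
  by (force simp: orbit_def transl_group_def transl_def aff_apply_def)

lemma orbit_transl_group_eq_iff:
  assumes "add_subgroup L"
  shows "orbit (transl_group L) x = orbit (transl_group L) y \<longleftrightarrow> x - y \<in> L"
proof
  assume "orbit (transl_group L) x = orbit (transl_group L) y"
  moreover have "x \<in> orbit (transl_group L) x"
    by (simp add: mem_orbit_transl_group add_subgroup_zero[OF assms])
  ultimately show "x - y \<in> L"
    by (simp add: mem_orbit_transl_group)
next
  assume "x - y \<in> L"
  then have "z - x \<in> L \<longleftrightarrow> z - y \<in> L" for z
    using add_subgroup_add[OF assms, of "z - x" "x - y"] add_subgroup_diff[OF assms, of "z - y" "x - y"]
    by auto
  then show "orbit (transl_group L) x = orbit (transl_group L) y"
    by (auto simp: mem_orbit_transl_group)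
qed

lemma induced_orbit:
  assumes L: "add_subgroup L" and \<phi>: "\<phi> \<in> lattice_normalizer L"
  shows "induced (transl_group L) \<phi> (orbit (transl_group L) x)
       = orbit (transl_group L) (aff_apply \<phi> x)"
proof -
  define y where "y = (SOME y. y \<in> orbit (transl_group L) x)"
  have "y \<in> orbit (transl_group L) x"
    unfolding y_def by (rule someI[of _ x]) (simp add: mem_orbit_transl_group add_subgroup_zero[OF L])
  then have "snd \<phi> *v (y - x) \<in> L"
    using \<phi> by (auto simp: mem_orbit_transl_group lattice_normalizer_def)
  then have "aff_apply \<phi> y - aff_apply \<phi> x \<in> L"
    by (simp add: aff_apply_def matrix_vector_mult_diff_distrib)
  then show ?thesis
    by (simp add: induced_def orbspace_def rangeI y_def orbit_transl_group_eq_iff[OF L])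
qed

lemma induced_extensional: "induced G \<phi> \<in> extensional (orbspace G)"
  by (simp add: induced_def)

lemma orbspace_fun_eqI:
  assumes "f \<in> extensional (orbspace G)" "g \<in> extensional (orbspace G)"
    and "\<And>x. f (orbit G x) = g (orbit G x)"
  shows "f = g"
  using assms by (intro extensionalityI[of f "orbspace G"]) (auto simp: orbspace_def)

lemma induced_eq_iff:
  assumes L: "add_subgroup L" and \<phi>: "\<phi> \<in> lattice_normalizer L" and \<psi>: "\<psi> \<in> lattice_normalizer L"
  shows "induced (transl_group L) \<phi> = induced (transl_group L) \<psi>
    \<longleftrightarrow> (\<forall>x. aff_apply \<phi> x - aff_apply \<psi> x \<in> L)"
proof
  assume "induced (transl_group L) \<phi> = induced (transl_group L) \<psi>"
  then show "\<forall>x. aff_apply \<phi> x - aff_apply \<psi> x \<in> L"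
    by (metis induced_orbit[OF L \<phi>] induced_orbit[OF L \<psi>] orbit_transl_group_eq_iff[OF L])
next
  assume "\<forall>x. aff_apply \<phi> x - aff_apply \<psi> x \<in> L"
  then show "induced (transl_group L) \<phi> = induced (transl_group L) \<psi>"
    by (intro orbspace_fun_eqI[where G = "transl_group L"] induced_extensional)
      (simp add: induced_orbit[OF L \<phi>] induced_orbit[OF L \<psi>] orbit_transl_group_eq_iff[OF L])
qed

lemma carrier_AffOrb_transl_group:
  "carrier (AffOrb (transl_group L)) = induced (transl_group L) ` lattice_normalizer L"
  by (simp add: AffOrb_def Aff_def aff_normalizer_transl_group)

lemma mult_AffOrb_transl_group:
  assumes L: "add_subgroup L" and \<phi>: "\<phi> \<in> lattice_normalizer L" and \<psi>: "\<psi> \<in> lattice_normalizer L"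
  shows "induced (transl_group L) \<phi> \<otimes>\<^bsub>AffOrb (transl_group L)\<^esub> induced (transl_group L) \<psi>
       = induced (transl_group L) (aff_comp \<phi> \<psi>)"
  unfolding AffOrb_def monoid.simps
proof (rule orbspace_fun_eqI[where G = "transl_group L"])
  fix x
  show "compose (orbspace (transl_group L)) (induced (transl_group L) \<phi>) (induced (transl_group L) \<psi>)
          (orbit (transl_group L) x) = induced (transl_group L) (aff_comp \<phi> \<psi>) (orbit (transl_group L) x)"
    by (simp add: compose_def orbspace_def induced_orbit[OF L] \<phi> \<psi> lattice_normalizer_comp
        aff_apply_comp)
qed (simp_all add: compose_def induced_extensional)

lemma one_AffOrb_transl_group:
  assumes L: "add_subgroup L"
  shows "\<one>\<^bsub>AffOrb (transl_group L)\<^esub> = induced (transl_group L) (0, mat 1)"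
  unfolding AffOrb_def monoid.simps
  by (rule orbspace_fun_eqI[where G = "transl_group L"])
    (simp_all add: induced_extensional induced_orbit[OF L lattice_normalizer_one] aff_apply_def,
     simp add: orbspace_def rangeI)

lemma group_AffOrb_transl_group:
  assumes L: "add_subgroup L"
  shows "group (AffOrb (transl_group L))"
proof (rule groupI)
  let ?G = "AffOrb (transl_group L)"
  note carrier = carrier_AffOrb_transl_group
  note mult = mult_AffOrb_transl_group[OF L]
  show "\<one>\<^bsub>?G\<^esub> \<in> carrier ?G"
    by (simp add: carrier one_AffOrb_transl_group[OF L] lattice_normalizer_one)
  fix x assume "x \<in> carrier ?G"
  then obtain \<phi> where \<phi>: "\<phi> \<in> lattice_normalizer L" and x: "x = induced (transl_group L) \<phi>"
    by (auto simp: carrier)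
  show "\<one>\<^bsub>?G\<^esub> \<otimes>\<^bsub>?G\<^esub> x = x"
    by (simp add: x one_AffOrb_transl_group[OF L] mult lattice_normalizer_one \<phi>)
      (simp add: aff_comp_def)
  have "aff_comp (aff_inv \<phi>) \<phi> = (0, mat 1)"
    using \<phi> by (simp add: aff_comp_inv_left lattice_normalizer_def)
  then have "induced (transl_group L) (aff_inv \<phi>) \<otimes>\<^bsub>?G\<^esub> x = \<one>\<^bsub>?G\<^esub>"
    by (simp add: x mult lattice_normalizer_inv \<phi> one_AffOrb_transl_group[OF L])
  then show "\<exists>y\<in>carrier ?G. y \<otimes>\<^bsub>?G\<^esub> x = \<one>\<^bsub>?G\<^esub>"
    using lattice_normalizer_inv[OF \<phi>] by (auto simp: carrier)
  fix y assume "y \<in> carrier ?G"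
  then obtain \<psi> where \<psi>: "\<psi> \<in> lattice_normalizer L" and y: "y = induced (transl_group L) \<psi>"
    by (auto simp: carrier)
  show "x \<otimes>\<^bsub>?G\<^esub> y \<in> carrier ?G"
    by (simp add: x y mult \<phi> \<psi> carrier lattice_normalizer_comp)
  fix z assume "z \<in> carrier ?G"
  then obtain \<theta> where \<theta>: "\<theta> \<in> lattice_normalizer L" and z: "z = induced (transl_group L) \<theta>"
    by (auto simp: carrier)
  show "x \<otimes>\<^bsub>?G\<^esub> y \<otimes>\<^bsub>?G\<^esub> z = x \<otimes>\<^bsub>?G\<^esub> (y \<otimes>\<^bsub>?G\<^esub> z)"
    by (simp add: x y z mult \<phi> \<psi> \<theta> lattice_normalizer_comp aff_comp_assoc)
qed

lemma inv_AffOrb_transl_group: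
  assumes L: "add_subgroup L" and \<phi>: "\<phi> \<in> lattice_normalizer L"
  shows "inv\<^bsub>AffOrb (transl_group L)\<^esub> (induced (transl_group L) \<phi>)
       = induced (transl_group L) (aff_inv \<phi>)"
  using \<phi> lattice_normalizer_inv[OF \<phi>]
  by (intro group.inv_equality[OF group_AffOrb_transl_group[OF L]])
    (auto simp: carrier_AffOrb_transl_group one_AffOrb_transl_group[OF L]
      mult_AffOrb_transl_group[OF L] aff_comp_inv_left lattice_normalizer_def)

section \<open>Isometries of flat tori\<close>

lemma orb_dist_orbit_transl_group:
  assumes L: "add_subgroup L"
  shows "orb_dist (orbit (transl_group L) x) (orbit (transl_group L) y) = infdist (x - y) L"
proof -
  have "{dist x' y' | x' y'. x' \<in> orbit (transl_group L) x \<and> y' \<in> orbit (transl_group L) y}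
      = (\<lambda>l. dist (x - y) l) ` L"
  proof (intro equalityI subsetI)
    fix d assume "d \<in> {dist x' y' | x' y'. x' \<in> orbit (transl_group L) x \<and> y' \<in> orbit (transl_group L) y}"
    then obtain x' y' where d: "d = dist x' y'" and "x' - x \<in> L" "y' - y \<in> L"
      by (auto simp: mem_orbit_transl_group)
    then have "(y' - y) - (x' - x) \<in> L"
      by (simp add: add_subgroup_diff[OF L])
    moreover have "d = dist (x - y) ((y' - y) - (x' - x))"
      by (simp add: d dist_norm algebra_simps)
    ultimately show "d \<in> (\<lambda>l. dist (x - y) l) ` L"
      by blast
  next
    fix d assume "d \<in> (\<lambda>l. dist (x - y) l) ` L"
    then obtain l where "l \<in> L" "d = dist (x - l) y"
      by (auto simp: dist_norm algebra_simps)
    moreover have "x - l \<in> orbit (transl_group L) x" "y \<in> orbit (transl_group L) y"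
      using \<open>l \<in> L\<close> by (simp_all add: mem_orbit_transl_group add_subgroup_minus[OF L]
          add_subgroup_zero[OF L])
    ultimately show "d \<in> {dist x' y' | x' y'. x' \<in> orbit (transl_group L) x \<and> y' \<in> orbit (transl_group L) y}"
      by blast
  qed
  moreover have "L \<noteq> {}"
    using add_subgroup_zero[OF L] by blast
  ultimately show ?thesis
    by (simp add: orb_dist_def infdist_notempty)
qed

lemma Sym_transl_group_iff:
  assumes L: "add_subgroup L"
  shows "f \<in> Sym (transl_group L) \<longleftrightarrow>
    (\<exists>\<phi>\<in>lattice_normalizer L. f = induced (transl_group L) \<phi> \<and>
       (\<forall>v. infdist (snd \<phi> *v v) L = infdist v L))"
proof -
  have "(\<forall>O1\<in>orbspace (transl_group L). \<forall>O2\<in>orbspace (transl_group L).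
      orb_dist (induced (transl_group L) \<phi> O1) (induced (transl_group L) \<phi> O2) = orb_dist O1 O2)
    \<longleftrightarrow> (\<forall>v. infdist (snd \<phi> *v v) L = infdist v L)"
    if \<phi>: "\<phi> \<in> lattice_normalizer L" for \<phi>
  proof -
    have "aff_apply \<phi> x - aff_apply \<phi> y = snd \<phi> *v (x - y)" for x y
      by (simp add: aff_apply_def matrix_vector_mult_diff_distrib)
    then have "(\<forall>O1\<in>orbspace (transl_group L). \<forall>O2\<in>orbspace (transl_group L).
        orb_dist (induced (transl_group L) \<phi> O1) (induced (transl_group L) \<phi> O2) = orb_dist O1 O2)
      \<longleftrightarrow> (\<forall>x y. infdist (snd \<phi> *v (x - y)) L = infdist (x - y) L)"
      by (simp add: orbspace_def induced_orbit[OF L \<phi>] orb_dist_orbit_transl_group[OF L])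
    also have "\<dots> \<longleftrightarrow> (\<forall>v. infdist (snd \<phi> *v v) L = infdist v L)"
      by (metis diff_zero)
    finally show ?thesis .
  qed
  then show ?thesis
    by (auto simp: Sym_def Aff_def aff_normalizer_transl_group)
qed

lemma infdist_orthogonal_transformation_image:
  assumes "orthogonal_transformation f"
  shows "infdist (f v) (f ` L) = infdist v L"
proof -
  have "dist (f v) (f l) = dist v l" for l
    using assms by (simp add: dist_norm orthogonal_transformation_norm
        linear_diff[OF orthogonal_transformation_linear, symmetric])
  then show ?thesis
    by (simp add: infdist_def image_image)
qed

lemma infdist_eq_norm_if_small:
  fixes v :: "'a::real_normed_vector"
  assumes "0 \<in> L" and sep: "\<And>l. l \<in> L \<Longrightarrow> l \<noteq> 0 \<Longrightarrow> r \<le> norm l" and v: "norm v \<le> r / 2"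
  shows "infdist v L = norm v"
proof (rule antisym)
  show "infdist v L \<le> norm v"
    using infdist_le[OF \<open>0 \<in> L\<close>, of v] by simp
  have "norm v \<le> dist v l" if "l \<in> L" for l
  proof (cases "l = 0")
    case False
    then have "r \<le> norm l"
      using sep that by blast
    moreover have "norm l - norm v \<le> dist v l"
      using norm_triangle_ineq2[of l v] by (simp add: dist_norm norm_minus_commute)
    ultimately show ?thesis
      using v by linarith
  qed simp
  moreover have "L \<noteq> {}"
    using \<open>0 \<in> L\<close> by blast
  ultimately show "norm v \<le> infdist v L"
    by (simp add: infdist_notempty cINF_greatest)
qed

lemma orthogonal_transformation_if_infdist_invariant:
  fixes X :: "real^2^2"
  assumes "0 \<in> L" and "r > 0" and sep: "\<And>l. l \<in> L \<Longrightarrow> l \<noteq> 0 \<Longrightarrow> r \<le> norm l"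
    and inv: "\<And>v. infdist (X *v v) L = infdist v L"
  shows "orthogonal_transformation ((*v) X)"
  unfolding orthogonal_transformation
proof (intro conjI allI)
  show "linear ((*v) X)"
    by (rule matrix_vector_mul_linear)
  fix w
  define t where "t = r / (2 * (norm w + norm (X *v w) + 1))"
  have pos: "norm w + norm (X *v w) + 1 > 0"
    by (simp add: add_nonneg_pos)
  then have t: "t > 0" and t_sum: "t * (norm w + norm (X *v w) + 1) = r / 2"
    using \<open>r > 0\<close> by (simp_all add: t_def, simp add: field_simps)
  then have "t * norm w \<le> r / 2" "t * norm (X *v w) \<le> r / 2"
    by (simp_all add: mult_left_mono flip: t_sum)
  \<comment> \<open>t w and X (t w) are so short that their distances to L are their norms\<close>
  have "norm (X *v (t *\<^sub>R w)) = norm (t *\<^sub>R w)"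
    using infdist_eq_norm_if_small[OF \<open>0 \<in> L\<close> sep] t \<open>t * norm w \<le> r / 2\<close>
      \<open>t * norm (X *v w) \<le> r / 2\<close> inv
    by (metis abs_of_pos matrix_vector_mult_scaleR norm_scaleR)
  then show "norm (X *v w) = norm w"
    using t by (simp add: matrix_vector_mult_scaleR)
qed

lemma Sym_transl_group:
  assumes L: "add_subgroup L" and "r > 0" and sep: "\<And>l. l \<in> L \<Longrightarrow> l \<noteq> 0 \<Longrightarrow> r \<le> norm l"
  shows "Sym (transl_group L) = {induced (transl_group L) \<phi> | \<phi>.
    \<phi> \<in> lattice_normalizer L \<and> orthogonal_transformation ((*v) (snd \<phi>))}"
proof -
  have "(\<forall>v. infdist (snd \<phi> *v v) L = infdist v L) \<longleftrightarrow> orthogonal_transformation ((*v) (snd \<phi>))"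
    if "\<phi> \<in> lattice_normalizer L" for \<phi>
    using that infdist_orthogonal_transformation_image[of "(*v) (snd \<phi>)" _ L]
      orthogonal_transformation_if_infdist_invariant[OF add_subgroup_zero[OF L] \<open>r > 0\<close> sep]
    by (auto simp: lattice_normalizer_def)
  then show ?thesis
    unfolding set_eq_iff Sym_transl_group_iff[OF L] by blast
qed

section \<open>Transport along an affine change of lattice\<close>

abbreviation aff_conj :: "affmap \<Rightarrow> affmap \<Rightarrow> affmap" where
  "aff_conj g \<phi> \<equiv> aff_comp (aff_comp g \<phi>) (aff_inv g)"

lemma aff_comp_inv_right: "invertible (snd g) \<Longrightarrow> aff_comp g (aff_inv g) = (0, mat 1)"
  using matrix_vector_mult_diff_distrib[of "snd g" 0 "matrix_inv (snd g) *v fst g"]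
  by (simp add: aff_comp_def aff_inv_def matrix_inv_right)

lemma aff_comp_one [simp]: "aff_comp (0, mat 1) f = f" "aff_comp f (0, mat 1) = f"
  by (simp_all add: aff_comp_def)

lemma snd_aff_conj: "snd (aff_conj g \<phi>) = snd g ** snd \<phi> ** matrix_inv (snd g)"
  by (simp add: aff_comp_def)

lemma aff_apply_conj:
  assumes "invertible (snd g)"
  shows "aff_apply (aff_conj g \<phi>) (aff_apply g x) = aff_apply g (aff_apply \<phi> x)"
proof -
  have "aff_apply (aff_inv g) (aff_apply g x) = x"
    using aff_apply_comp[of "aff_inv g" g x] by (simp add: aff_comp_inv_left assms aff_apply_def)
  then show ?thesis
    by (simp add: aff_apply_comp)
qed

lemma aff_comp_inv_cancel:
  assumes "invertible (snd g)"
  shows "aff_comp (aff_inv g) (aff_comp g h) = h" "aff_comp g (aff_comp (aff_inv g) h) = h"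
  by (simp_all add: assms aff_comp_inv_left aff_comp_inv_right flip: aff_comp_assoc)

lemma aff_conj_comp:
  assumes "invertible (snd g)"
  shows "aff_conj g (aff_comp \<phi> \<psi>) = aff_comp (aff_conj g \<phi>) (aff_conj g \<psi>)"
  by (simp add: aff_comp_assoc aff_comp_inv_cancel[OF assms])

lemma aff_conj_conj_inv:
  assumes "invertible (snd g)"
  shows "aff_conj g (aff_conj (aff_inv g) \<psi>) = \<psi>"
  using aff_comp_inv_left[of "aff_inv g"] invertible_matrix_inv[OF assms]
  by (simp add: aff_comp_assoc aff_comp_inv_cancel[OF assms])

lemma add_subgroup_linear_image:
  assumes "linear f" "add_subgroup L"
  shows "add_subgroup (f ` L)"
proof -
  have "0 = f 0" "f x - f y = f (x - y)" for x y
    by (simp_all add: linear_0 linear_diff assms(1))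
  then show ?thesis
    using assms(2) unfolding add_subgroup_def by (metis image_eqI imageE)
qed

lemma aff_conj_in_lattice_normalizer:
  assumes g: "invertible (snd g)" and \<phi>: "\<phi> \<in> lattice_normalizer L"
  shows "aff_conj g \<phi> \<in> lattice_normalizer ((*v) (snd g) ` L)"
proof -
  have "(*v) (snd g ** snd \<phi> ** matrix_inv (snd g)) ` (*v) (snd g) ` L = (*v) (snd g) ` (*v) (snd \<phi>) ` L"
    using g by (simp add: image_image flip: matrix_vector_mul_assoc)
  then show ?thesis
    using g \<phi> by (simp add: lattice_normalizer_def snd_aff_conj invertible_mult invertible_matrix_inv)
qed

lemma aff_conj_inv_in_lattice_normalizer:
  assumes g: "invertible (snd g)" and \<psi>: "\<psi> \<in> lattice_normalizer ((*v) (snd g) ` L)"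
  shows "aff_conj (aff_inv g) \<psi> \<in> lattice_normalizer L"
  using aff_conj_in_lattice_normalizer[of "aff_inv g", OF _ \<psi>] g
  by (simp add: image_image invertible_matrix_inv)

context
  fixes L :: "(real^2) set" and g :: affmap
  assumes L: "add_subgroup L" and g: "invertible (snd g)"
begin

lemma add_subgroup_image: "add_subgroup ((*v) (snd g) ` L)"
  by (rule add_subgroup_linear_image[OF matrix_vector_mul_linear L])

lemma lattice_normalizer_image:
  "lattice_normalizer ((*v) (snd g) ` L) = aff_conj g ` lattice_normalizer L"
proof
  show "aff_conj g ` lattice_normalizer L \<subseteq> lattice_normalizer ((*v) (snd g) ` L)"
    using aff_conj_in_lattice_normalizer[OF g] by (rule image_subsetI)
  show "lattice_normalizer ((*v) (snd g) ` L) \<subseteq> aff_conj g ` lattice_normalizer L"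
  proof
    fix \<psi> assume "\<psi> \<in> lattice_normalizer ((*v) (snd g) ` L)"
    then show "\<psi> \<in> aff_conj g ` lattice_normalizer L"
      by (intro image_eqI[of \<psi> "aff_conj g" "aff_conj (aff_inv g) \<psi>"])
        (simp_all add: aff_conj_conj_inv[OF g] aff_conj_inv_in_lattice_normalizer[OF g])
  qed
qed

lemma induced_aff_conj_eq_iff:
  assumes \<phi>: "\<phi> \<in> lattice_normalizer L" and \<psi>: "\<psi> \<in> lattice_normalizer L"
  shows "induced (transl_group ((*v) (snd g) ` L)) (aff_conj g \<phi>)
      = induced (transl_group ((*v) (snd g) ` L)) (aff_conj g \<psi>)
    \<longleftrightarrow> induced (transl_group L) \<phi> = induced (transl_group L) \<psi>"
proof -
  have diff: "aff_apply (aff_conj g \<phi>) (aff_apply g x) - aff_apply (aff_conj g \<psi>) (aff_apply g x)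
      = snd g *v (aff_apply \<phi> x - aff_apply \<psi> x)" for x
    by (simp add: aff_apply_conj[OF g]) (simp add: aff_apply_def matrix_vector_mult_diff_distrib)
  have "aff_apply g (aff_apply (aff_inv g) y) = y" for y
    using aff_apply_comp[of g "aff_inv g" y] by (simp add: aff_comp_inv_right[OF g] aff_apply_def)
  then have "(\<forall>y. aff_apply (aff_conj g \<phi>) y - aff_apply (aff_conj g \<psi>) y \<in> (*v) (snd g) ` L)
      \<longleftrightarrow> (\<forall>x. snd g *v (aff_apply \<phi> x - aff_apply \<psi> x) \<in> (*v) (snd g) ` L)"
    unfolding diff[symmetric] by metis
  also have "\<dots> \<longleftrightarrow> (\<forall>x. aff_apply \<phi> x - aff_apply \<psi> x \<in> L)"
    using inj_matrix_vector_mult[OF g] by (simp add: inj_image_mem_iff)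
  finally show ?thesis
    by (simp add: induced_eq_iff L add_subgroup_image aff_conj_in_lattice_normalizer g \<phi> \<psi>)
qed

lemma sharp_induced:
  assumes \<phi>: "\<phi> \<in> lattice_normalizer L"
  shows "sharp g (transl_group L) (transl_group ((*v) (snd g) ` L)) (induced (transl_group L) \<phi>)
       = induced (transl_group ((*v) (snd g) ` L)) (aff_conj g \<phi>)"
proof -
  define \<psi> where "\<psi> = (SOME \<psi>. \<psi> \<in> aff_normalizer (transl_group L)
                              \<and> induced (transl_group L) \<psi> = induced (transl_group L) \<phi>)"
  have "\<psi> \<in> lattice_normalizer L \<and> induced (transl_group L) \<psi> = induced (transl_group L) \<phi>"
    unfolding \<psi>_def aff_normalizer_transl_group by (rule someI[of _ \<phi>]) (simp add: \<phi>)
  then have "induced (transl_group ((*v) (snd g) ` L)) (aff_conj g \<psi>)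
      = induced (transl_group ((*v) (snd g) ` L)) (aff_conj g \<phi>)"
    using induced_aff_conj_eq_iff[OF _ \<phi>] by blast
  then show ?thesis
    unfolding sharp_def \<psi>_def .
qed

lemma sharp_iso:
  "sharp g (transl_group L) (transl_group ((*v) (snd g) ` L))
     \<in> iso (AffOrb (transl_group L)) (AffOrb (transl_group ((*v) (snd g) ` L)))"
proof -
  let ?L' = "(*v) (snd g) ` L"
  let ?s = "sharp g (transl_group L) (transl_group ?L')"
  note carrier = carrier_AffOrb_transl_group
  have closed: "?s x \<in> carrier (AffOrb (transl_group ?L'))"
    if "x \<in> carrier (AffOrb (transl_group L))" for x
    using that aff_conj_in_lattice_normalizer[OF g] by (auto simp: carrier sharp_induced)
  have "?s (x \<otimes>\<^bsub>AffOrb (transl_group L)\<^esub> y) = ?s x \<otimes>\<^bsub>AffOrb (transl_group ?L')\<^esub> ?s y"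
    if x: "x \<in> carrier (AffOrb (transl_group L))" and y: "y \<in> carrier (AffOrb (transl_group L))"
    for x y
  proof -
    obtain \<phi> \<psi> where \<phi>: "\<phi> \<in> lattice_normalizer L" "x = induced (transl_group L) \<phi>"
      and \<psi>: "\<psi> \<in> lattice_normalizer L" "y = induced (transl_group L) \<psi>"
      using x y unfolding carrier by blast
    show ?thesis
      by (simp add: \<phi> \<psi> mult_AffOrb_transl_group L add_subgroup_image lattice_normalizer_comp
          sharp_induced aff_conj_in_lattice_normalizer g aff_conj_comp)
  qed
  then have "?s \<in> hom (AffOrb (transl_group L)) (AffOrb (transl_group ?L'))"
    using closed by (intro homI)
  moreover have "inj_on ?s (carrier (AffOrb (transl_group L)))"
  proof (rule inj_onI)
    fix x y
    assume "x \<in> carrier (AffOrb (transl_group L))" "y \<in> carrier (AffOrb (transl_group L))"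
    then obtain \<phi> \<psi> where \<phi>: "\<phi> \<in> lattice_normalizer L" "x = induced (transl_group L) \<phi>"
      and \<psi>: "\<psi> \<in> lattice_normalizer L" "y = induced (transl_group L) \<psi>"
      unfolding carrier by blast
    then show "?s x = ?s y \<Longrightarrow> x = y"
      by (simp add: sharp_induced induced_aff_conj_eq_iff)
  qed
  moreover have "carrier (AffOrb (transl_group ?L')) \<subseteq> ?s ` carrier (AffOrb (transl_group L))"
  proof
    fix f assume "f \<in> carrier (AffOrb (transl_group ?L'))"
    then obtain \<psi> where \<psi>: "\<psi> \<in> lattice_normalizer ?L'" and f: "f = induced (transl_group ?L') \<psi>"
      unfolding carrier by (rule imageE)
    from \<psi> obtain \<phi> where \<phi>: "\<phi> \<in> lattice_normalizer L" and "\<psi> = aff_conj g \<phi>"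
      unfolding lattice_normalizer_image by (rule imageE)
    then have "f = ?s (induced (transl_group L) \<phi>)"
      by (simp add: f sharp_induced)
    moreover have "induced (transl_group L) \<phi> \<in> carrier (AffOrb (transl_group L))"
      unfolding carrier using \<phi> by (rule imageI)
    ultimately show "f \<in> ?s ` carrier (AffOrb (transl_group L))"
      by (rule image_eqI)
  qed
  ultimately show ?thesis
    using closed by (auto simp: iso_def bij_betw_def)
qed

lemma Sym_transl_group_image:
  assumes "r > 0" and sep: "\<And>l. l \<in> (*v) (snd g) ` L \<Longrightarrow> l \<noteq> 0 \<Longrightarrow> r \<le> norm l"
  shows "Sym (transl_group ((*v) (snd g) ` L))
    = sharp g (transl_group L) (transl_group ((*v) (snd g) ` L)) `
        {induced (transl_group L) \<phi> | \<phi>. \<phi> \<in> lattice_normalizer L \<and>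
           orthogonal_transformation ((*v) (snd g ** snd \<phi> ** matrix_inv (snd g)))}"
    (is "_ = ?s ` {_ | \<phi>. \<phi> \<in> _ \<and> ?orth \<phi>}")
proof -
  let ?L' = "(*v) (snd g) ` L"
  have "{\<psi>. \<psi> \<in> lattice_normalizer ?L' \<and> orthogonal_transformation ((*v) (snd \<psi>))}
      = {\<psi>. \<psi> \<in> aff_conj g ` lattice_normalizer L \<and> orthogonal_transformation ((*v) (snd \<psi>))}"
    by (simp only: lattice_normalizer_image)
  also have "\<dots> = aff_conj g ` {\<phi>. \<phi> \<in> lattice_normalizer L \<and> ?orth \<phi>}"
    by (auto simp: snd_aff_conj)
  finally have conj: "{\<psi>. \<psi> \<in> lattice_normalizer ?L' \<and> orthogonal_transformation ((*v) (snd \<psi>))}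
      = aff_conj g ` {\<phi>. \<phi> \<in> lattice_normalizer L \<and> ?orth \<phi>}" .
  have "Sym (transl_group ?L') = {induced (transl_group ?L') \<psi> | \<psi>.
      \<psi> \<in> lattice_normalizer ?L' \<and> orthogonal_transformation ((*v) (snd \<psi>))}"
    by (rule Sym_transl_group[OF add_subgroup_image \<open>r > 0\<close> sep])
  also have "\<dots> = induced (transl_group ?L') ` aff_conj g ` {\<phi>. \<phi> \<in> lattice_normalizer L \<and> ?orth \<phi>}"
    by (simp only: setcompr_eq_image conj)
  also have "\<dots> = ?s ` induced (transl_group L) ` {\<phi>. \<phi> \<in> lattice_normalizer L \<and> ?orth \<phi>}"
    unfolding image_image by (rule image_cong) (simp_all add: sharp_induced)
  finally show ?thesis
    by (simp only: setcompr_eq_image)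
qed

end

section \<open>Generators of the affinity group\<close>

inductive_set matrix_words :: "(real^2^2) set \<Rightarrow> (real^2^2) set" for G where
  mat_1: "mat 1 \<in> matrix_words G"
| mult: "X \<in> G \<Longrightarrow> Y \<in> matrix_words G \<Longrightarrow> X ** Y \<in> matrix_words G"

lemma matrix_words_generator: "X \<in> G \<Longrightarrow> X \<in> matrix_words G"
  using matrix_words.mult[OF _ matrix_words.mat_1] by simp

lemma matrix_words_mult: "X \<in> matrix_words G \<Longrightarrow> Y \<in> matrix_words G \<Longrightarrow> X ** Y \<in> matrix_words G"
  by (induction X rule: matrix_words.induct) (simp_all add: matrix_words.mult matrix_mul_assoc[symmetric])

lemma transl_comp_linmap: "aff_comp (transl (fst \<phi>)) (linmap (snd \<phi>)) = \<phi>"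
  by (simp add: aff_comp_def transl_def linmap_def)

lemma snd_linmap [simp]: "snd (linmap X) = X"
  by (simp add: linmap_def)

lemma aff_comp_linmap: "aff_comp (linmap X) (linmap Y) = linmap (X ** Y)"
  by (simp add: aff_comp_def linmap_def)

lemma generate_transl_linmap_subset:
  fixes L :: "(real^2) set" and P :: "real^2^2 \<Rightarrow> bool"
  assumes L: "add_subgroup L"
    and P_one: "P (mat 1)" and P_mult: "\<And>X Y. P X \<Longrightarrow> P Y \<Longrightarrow> P (X ** Y)"
    and P_inv: "\<And>X. invertible X \<Longrightarrow> P X \<Longrightarrow> P (matrix_inv X)"
    and gens: "\<And>X. X \<in> G \<Longrightarrow> linmap X \<in> lattice_normalizer L \<and> P X"
  shows "generate (AffOrb (transl_group L)) (induced (transl_group L) ` (range transl \<union> linmap ` G))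
    \<subseteq> {induced (transl_group L) \<phi> | \<phi>. \<phi> \<in> lattice_normalizer L \<and> P (snd \<phi>)}"
    (is "generate ?G ?H \<subseteq> ?S")
proof
  have gens_S: "h \<in> ?S" if "h \<in> ?H" for h
  proof -
    have "P (snd (transl a))" for a
      using P_one by (simp add: transl_def)
    moreover have "P (snd (linmap X))" if "X \<in> G" for X
      using gens[OF that] by (simp add: linmap_def)
    ultimately show ?thesis
      using \<open>h \<in> ?H\<close> gens transl_in_lattice_normalizer by blast
  qed
  have inv_S: "inv\<^bsub>?G\<^esub> h \<in> ?S" if "h \<in> ?S" for h
  proof -
    obtain \<phi> where \<phi>: "\<phi> \<in> lattice_normalizer L" "P (snd \<phi>)" and h: "h = induced (transl_group L) \<phi>"
      using \<open>h \<in> ?S\<close> by blast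
    have "P (snd (aff_inv \<phi>))"
      using \<phi> P_inv by (simp add: lattice_normalizer_def)
    then show ?thesis
      unfolding h inv_AffOrb_transl_group[OF L \<phi>(1)] using lattice_normalizer_inv[OF \<phi>(1)] by blast
  qed
  fix h assume "h \<in> generate ?G ?H"
  then show "h \<in> ?S"
  proof induction
    case one
    show ?case
      using P_one lattice_normalizer_one by (force simp: one_AffOrb_transl_group[OF L])
  next
    case (incl h)
    then show ?case by (rule gens_S)
  next
    case (inv h)
    then show ?case by (intro inv_S gens_S)
  next
    case (eng h1 h2)
    then obtain \<phi> \<psi> where "\<phi> \<in> lattice_normalizer L" "P (snd \<phi>)" "h1 = induced (transl_group L) \<phi>"
      "\<psi> \<in> lattice_normalizer L" "P (snd \<psi>)" "h2 = induced (transl_group L) \<psi>"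
      by blast
    then show ?case
      using lattice_normalizer_comp P_mult
      by (force simp: mult_AffOrb_transl_group[OF L] aff_comp_def)
  qed
qed

lemma linmap_words_in_generate:
  assumes L: "add_subgroup L" and gens: "\<And>X. X \<in> G \<Longrightarrow> linmap X \<in> lattice_normalizer L"
    and "X \<in> matrix_words G"
  shows "linmap X \<in> lattice_normalizer L \<and> induced (transl_group L) (linmap X)
    \<in> generate (AffOrb (transl_group L)) (induced (transl_group L) ` (range transl \<union> linmap ` G))"
  using \<open>X \<in> matrix_words G\<close>
proof induction
  case mat_1
  have "induced (transl_group L) (linmap (mat 1)) = \<one>\<^bsub>AffOrb (transl_group L)\<^esub>"
    by (simp add: one_AffOrb_transl_group[OF L] linmap_def)
  then show ?case
    using generate.one lattice_normalizer_one by (metis linmap_def)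
next
  case (mult X Y)
  then have "induced (transl_group L) (linmap (X ** Y))
      = induced (transl_group L) (linmap X) \<otimes>\<^bsub>AffOrb (transl_group L)\<^esub> induced (transl_group L) (linmap Y)"
    using gens by (simp add: mult_AffOrb_transl_group[OF L] aff_comp_linmap)
  moreover have "induced (transl_group L) (linmap X)
      \<in> generate (AffOrb (transl_group L)) (induced (transl_group L) ` (range transl \<union> linmap ` G))"
    using mult(1) by (intro generate.incl) blast
  ultimately show ?case
    using mult gens lattice_normalizer_comp[of "linmap X" L "linmap Y"]
    by (simp add: generate.eng aff_comp_linmap)
qed

lemma generate_AffOrb_transl_group:
  fixes L :: "(real^2) set" and P :: "real^2^2 \<Rightarrow> bool"
  assumes L: "add_subgroup L"
    and P_one: "P (mat 1)" and P_mult: "\<And>X Y. P X \<Longrightarrow> P Y \<Longrightarrow> P (X ** Y)"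
    and P_inv: "\<And>X. invertible X \<Longrightarrow> P X \<Longrightarrow> P (matrix_inv X)"
    and gens: "\<And>X. X \<in> G \<Longrightarrow> linmap X \<in> lattice_normalizer L \<and> P X"
    and words: "\<And>X. linmap X \<in> lattice_normalizer L \<Longrightarrow> P X \<Longrightarrow> X \<in> matrix_words G"
  shows "generate (AffOrb (transl_group L)) (induced (transl_group L) ` (range transl \<union> linmap ` G))
    = {induced (transl_group L) \<phi> | \<phi>. \<phi> \<in> lattice_normalizer L \<and> P (snd \<phi>)}"
    (is "generate ?G ?H = ?S")
proof
  show "generate ?G ?H \<subseteq> ?S"
    by (rule generate_transl_linmap_subset[OF L P_one P_mult P_inv gens])
  show "?S \<subseteq> generate ?G ?H"
  proof
    fix h assume "h \<in> ?S"
    then obtain \<phi> where \<phi>: "\<phi> \<in> lattice_normalizer L" "P (snd \<phi>)" and h: "h = induced (transl_group L) \<phi>"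
      by blast
    have lin: "linmap (snd \<phi>) \<in> lattice_normalizer L"
      using \<phi>(1) by (simp add: lattice_normalizer_def linmap_def)
    have "h = induced (transl_group L) (transl (fst \<phi>)) \<otimes>\<^bsub>?G\<^esub> induced (transl_group L) (linmap (snd \<phi>))"
      by (simp add: h mult_AffOrb_transl_group[OF L] transl_in_lattice_normalizer lin transl_comp_linmap)
    moreover have "induced (transl_group L) (transl (fst \<phi>)) \<in> generate ?G ?H"
      by (intro generate.incl) blast
    moreover have "induced (transl_group L) (linmap (snd \<phi>)) \<in> generate ?G ?H"
      using linmap_words_in_generate[OF L _ words[OF lin \<phi>(2)]] gens by (simp add: linmap_def)
    ultimately show "h \<in> generate ?G ?H"
      by (simp add: generate.eng)
  qed
qed

section \<open>The square and the hexagonal lattice\<close>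

definition integer_lattice :: "(real^'n) set" where
  "integer_lattice = {x. \<forall>i. x $ i \<in> \<int>}"

lemma add_subgroup_integer_lattice: "add_subgroup integer_lattice"
  by (simp add: add_subgroup_def integer_lattice_def)

lemma one_le_norm_integer_lattice:
  assumes "x \<in> integer_lattice" "x \<noteq> 0"
  shows "1 \<le> norm x"
proof -
  obtain i where "x $ i \<noteq> 0"
    using assms(2) by (auto simp: vec_eq_iff)
  moreover have "x $ i \<in> \<int>"
    using assms(1) by (simp add: integer_lattice_def)
  ultimately have "1 \<le> \<bar>x $ i\<bar>"
    by (rule Ints_nonzero_abs_ge1[rotated])
  then show ?thesis
    using component_le_norm_cart[of x i] by linarith
qed

lemma vec2_eq_iff: "(x::real^2) = y \<longleftrightarrow> x $ 1 = y $ 1 \<and> x $ 2 = y $ 2"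
  by (simp add: vec_eq_iff forall_2)

lemma mat2_eq_iff:
  "(X::real^2^2) = Y \<longleftrightarrow> X$1$1 = Y$1$1 \<and> X$1$2 = Y$1$2 \<and> X$2$1 = Y$2$1 \<and> X$2$2 = Y$2$2"
  by (simp add: vec_eq_iff forall_2)

lemma mat2_mult_vector:
  "(X::real^2^2) *v v = vector [X$1$1 * v$1 + X$1$2 * v$2, X$2$1 * v$1 + X$2$2 * v$2]"
  by (simp add: vec2_eq_iff matrix_vector_mult_def sum_2)

lemma mat2_mult:
  "(vector [vector [a, b], vector [c, d]] :: real^2^2) ** vector [vector [a', b'], vector [c', d']]
    = (vector [vector [a * a' + b * c', a * b' + b * d'], vector [c * a' + d * c', c * b' + d * d']]
        :: real^2^2)"
  unfolding mat2_eq_iff by (simp add: matrix_matrix_mult_def sum_2)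

lemma mat2_1: "(mat 1 :: real^2^2) = vector [vector [1, 0], vector [0, 1]]"
  by (simp add: mat2_eq_iff mat_def)

lemma norm2_sq: "(norm (x::real^2))\<^sup>2 = (x $ 1)\<^sup>2 + (x $ 2)\<^sup>2"
  by (simp add: norm_vec_def L2_set_def UNIV_2)

lemma e1_components [simp]: "e1 $ 1 = 1" "e1 $ 2 = 0"
  by (simp_all add: e1_def)

lemma e2_components [simp]: "e2 $ 1 = 0" "e2 $ 2 = 1"
  by (simp_all add: e2_def)

lemma integer_lattice_2: "(x::real^2) \<in> integer_lattice \<longleftrightarrow> x $ 1 \<in> \<int> \<and> x $ 2 \<in> \<int>"
  by (simp add: integer_lattice_def forall_2)

lemma int_lattice_e1_e2: "int_lattice e1 e2 = integer_lattice"
proof (intro equalityI subsetI)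
  fix x :: "real^2" assume "x \<in> integer_lattice"
  then obtain m n where "x $ 1 = of_int m" "x $ 2 = of_int n"
    by (auto simp: integer_lattice_2 elim!: Ints_cases)
  then have "x = of_int m *\<^sub>R e1 + of_int n *\<^sub>R e2"
    by (simp add: vec2_eq_iff)
  then show "x \<in> int_lattice e1 e2"
    by (auto simp: int_lattice_def)
qed (auto simp: int_lattice_def integer_lattice_2)

lemma Mgrp_eq: "Mgrp = transl_group integer_lattice"
  by (simp add: Mgrp_def generate_transl_pair int_lattice_e1_e2)

lemma Dmat_mult_vector: "Dmat *v x = vector [x $ 1 - x $ 2 / 2, sqrt 3 / 2 * x $ 2]"
  by (simp add: mat2_mult_vector Dmat_def)

lemma invertible_Dmat: "invertible Dmat"
proof -
  have "Dmat ** vector [vector [1, 1 / sqrt 3], vector [0, 2 / sqrt 3]] = mat 1"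
    by (simp add: Dmat_def mat2_mult mat2_1 field_simps)
  then show ?thesis
    using invertible_right_inverse by blast
qed

lemma hexagonal_lattice_eq:
  "int_lattice e1 ((1/2) *\<^sub>R e1 + (sqrt 3 / 2) *\<^sub>R e2) = (*v) Dmat ` integer_lattice"
proof (intro equalityI subsetI)
  fix y assume "y \<in> int_lattice e1 ((1/2) *\<^sub>R e1 + (sqrt 3 / 2) *\<^sub>R e2)"
  then obtain m n :: int where y: "y = of_int m *\<^sub>R e1 + of_int n *\<^sub>R ((1/2) *\<^sub>R e1 + (sqrt 3 / 2) *\<^sub>R e2)"
    by (auto simp: int_lattice_def)
  have "y = Dmat *v (of_int (m + n) *\<^sub>R e1 + of_int n *\<^sub>R e2)"
    by (simp add: y Dmat_mult_vector vec2_eq_iff algebra_simps)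
  moreover have "of_int (m + n) *\<^sub>R e1 + of_int n *\<^sub>R e2 \<in> integer_lattice"
    by (simp add: integer_lattice_2)
  ultimately show "y \<in> (*v) Dmat ` integer_lattice"
    by blast
next
  fix y assume "y \<in> (*v) Dmat ` integer_lattice"
  then obtain m n :: int where "y = Dmat *v (of_int m *\<^sub>R e1 + of_int n *\<^sub>R e2)"
    by (auto simp flip: int_lattice_e1_e2 simp: int_lattice_def)
  then have "y = of_int (m - n) *\<^sub>R e1 + of_int n *\<^sub>R ((1/2) *\<^sub>R e1 + (sqrt 3 / 2) *\<^sub>R e2)"
    by (simp add: Dmat_mult_vector vec2_eq_iff algebra_simps)
  then show "y \<in> int_lattice e1 ((1/2) *\<^sub>R e1 + (sqrt 3 / 2) *\<^sub>R e2)"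
    unfolding int_lattice_def by blast
qed

lemma Lgrp_eq: "Lgrp = transl_group ((*v) Dmat ` integer_lattice)"
  by (simp add: Lgrp_def generate_transl_pair hexagonal_lattice_eq)

lemma norm_Dmat_sq: "(norm (Dmat *v v))\<^sup>2 = (v $ 1)\<^sup>2 - v $ 1 * v $ 2 + (v $ 2)\<^sup>2"
proof -
  have sqrt3: "sqrt 3 * (sqrt 3 * t) = 3 * t" for t :: real
    by (simp flip: mult.assoc)
  show ?thesis
    unfolding norm2_sq Dmat_mult_vector vector_2 by (simp add: sqrt3 power2_eq_square algebra_simps)
qed

lemma one_le_norm_hexagonal_lattice:
  assumes "y \<in> (*v) Dmat ` integer_lattice" "y \<noteq> 0"
  shows "1 \<le> norm y"
proof -
  obtain x where x: "x \<in> integer_lattice" "y = Dmat *v x"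
    using assms(1) by blast
  then obtain m n where mn: "x $ 1 = of_int m" "x $ 2 = of_int n"
    by (auto simp: integer_lattice_2 elim!: Ints_cases)
  have "x \<noteq> 0"
    using assms(2) x(2) by auto
  then have "m \<noteq> 0 \<or> n \<noteq> 0"
    using mn by (auto simp: vec2_eq_iff)
  then have "0 < (2 * m - n)\<^sup>2 + 3 * n\<^sup>2"
    by (cases "n = 0") (simp_all add: add_nonneg_pos)
  also have "(2 * m - n)\<^sup>2 + 3 * n\<^sup>2 = 4 * (m\<^sup>2 - m * n + n\<^sup>2)"
    by (simp add: power2_eq_square algebra_simps)
  finally have "real_of_int 1 \<le> real_of_int (m\<^sup>2 - m * n + n\<^sup>2)"
    by (simp only: of_int_le_iff) simp
  then have "1 \<le> (norm y)\<^sup>2"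
    by (simp add: x(2) norm_Dmat_sq mn)
  then show ?thesis
    using abs_le_square_iff[of 1 "norm y"] by simp
qed

section \<open>Point groups of the two lattices\<close>

definition orthogonal_wrt :: "real^'n^'n \<Rightarrow> real^'n^'n \<Rightarrow> bool" where
  "orthogonal_wrt Q X \<longleftrightarrow> (\<forall>v. norm (Q *v (X *v v)) = norm (Q *v v))"

lemma orthogonal_wrt_mat_1: "orthogonal_wrt Q (mat 1)"
  by (simp add: orthogonal_wrt_def)

lemma orthogonal_wrt_mult: "orthogonal_wrt Q X \<Longrightarrow> orthogonal_wrt Q Y \<Longrightarrow> orthogonal_wrt Q (X ** Y)"
  by (simp add: orthogonal_wrt_def flip: matrix_vector_mul_assoc)

lemma orthogonal_wrt_matrix_inv:
  "invertible X \<Longrightarrow> orthogonal_wrt Q X \<Longrightarrow> orthogonal_wrt Q (matrix_inv X)"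
  unfolding orthogonal_wrt_def by (metis matrix_inv_mult_vector(2))

lemma orthogonal_wrt_iff:
  assumes Q: "invertible Q"
  shows "orthogonal_wrt Q X \<longleftrightarrow> orthogonal_transformation ((*v) (Q ** X ** matrix_inv Q))"
proof -
  have conj: "(Q ** X ** matrix_inv Q) *v (Q *v v) = Q *v (X *v v)" for v
    by (simp add: Q flip: matrix_vector_mul_assoc)
  have "orthogonal_wrt Q X \<longleftrightarrow> (\<forall>w. norm ((Q ** X ** matrix_inv Q) *v w) = norm w)"
  proof
    assume "orthogonal_wrt Q X"
    then show "\<forall>w. norm ((Q ** X ** matrix_inv Q) *v w) = norm w"
      using conj[of "matrix_inv Q *v _"] by (simp add: orthogonal_wrt_def Q)
  qed (simp add: orthogonal_wrt_def flip: conj)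
  then show ?thesis
    by (simp add: orthogonal_transformation matrix_vector_mul_linear)
qed

lemma orthogonal_wrt_mat_1_iff: "orthogonal_wrt (mat 1) X \<longleftrightarrow> orthogonal_transformation ((*v) X)"
  by (simp add: orthogonal_wrt_def orthogonal_transformation matrix_vector_mul_linear)

lemma orthogonal_wrt_sq:
  "orthogonal_wrt Q X \<longleftrightarrow> (\<forall>v. (norm (Q *v (X *v v)))\<^sup>2 = (norm (Q *v v))\<^sup>2)"
  by (simp add: orthogonal_wrt_def power2_eq_iff_nonneg)

lemma integral_matrix_cases:
  fixes X :: "real^2^2"
  assumes "(*v) X ` integer_lattice = integer_lattice"
  obtains a b c d :: int
    where "X = vector [vector [of_int a, of_int b], vector [of_int c, of_int d]]"
proof -
  have "X *v e1 \<in> integer_lattice" "X *v e2 \<in> integer_lattice"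
    using assms by (auto simp: integer_lattice_2)
  then have "X$1$1 \<in> \<int>" "X$1$2 \<in> \<int>" "X$2$1 \<in> \<int>" "X$2$2 \<in> \<int>"
    by (simp_all add: integer_lattice_2 mat2_mult_vector)
  then obtain a b c d where "X$1$1 = of_int a" "X$1$2 = of_int b" "X$2$1 = of_int c" "X$2$2 = of_int d"
    by (metis Ints_cases)
  then show ?thesis
    using that by (simp add: mat2_eq_iff)
qed

lemma involution_in_lattice_normalizer:
  fixes a b c d :: int
  defines "X \<equiv> vector [vector [of_int a, of_int b], vector [of_int c, of_int d]] :: real^2^2"
  assumes "X ** X = mat 1"
  shows "linmap X \<in> lattice_normalizer integer_lattice"
proof -
  have maps: "X *v v \<in> integer_lattice" if "v \<in> integer_lattice" for v
    using that by (simp add: X_def integer_lattice_2 mat2_mult_vector Ints_add Ints_mult)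
  have "v = X *v (X *v v)" for v
    by (simp add: matrix_vector_mul_assoc assms(2))
  then have "integer_lattice \<subseteq> (*v) X ` integer_lattice"
    using maps by blast
  then have "(*v) X ` integer_lattice = integer_lattice"
    using maps by blast
  moreover have "invertible X"
    using assms(2) invertible_def by blast
  ultimately show ?thesis
    by (simp add: lattice_normalizer_def linmap_def)
qed

lemma int_square_le_1:
  fixes x :: int
  assumes "x\<^sup>2 \<le> 1"
  shows "x = -1 \<or> x = 0 \<or> x = 1"
proof -
  have "\<bar>x\<bar> \<le> 1"
    using assms abs_le_square_iff[of x 1] by simp
  then show ?thesis
    by linarith
qed

lemma square_form_solutions:
  fixes a b c d :: int
  assumes "a\<^sup>2 + c\<^sup>2 = 1" "b\<^sup>2 + d\<^sup>2 = 1" "(a + b)\<^sup>2 + (c + d)\<^sup>2 = 2"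
  shows "(a, b, c, d) \<in> {(1, 0, 0, 1), (-1, 0, 0, 1), (0, 1, 1, 0), (0, -1, 1, 0),
                          (0, 1, -1, 0), (0, -1, -1, 0), (1, 0, 0, -1), (-1, 0, 0, -1)}"
proof -
  have "a\<^sup>2 \<le> 1" "b\<^sup>2 \<le> 1" "c\<^sup>2 \<le> 1" "d\<^sup>2 \<le> 1"
    using assms(1,2) zero_le_power2[of a] zero_le_power2[of b] zero_le_power2[of c]
      zero_le_power2[of d] by linarith+
  then have "a = -1 \<or> a = 0 \<or> a = 1" "b = -1 \<or> b = 0 \<or> b = 1"
    "c = -1 \<or> c = 0 \<or> c = 1" "d = -1 \<or> d = 0 \<or> d = 1"
    by (simp_all add: int_square_le_1)
  then show ?thesis
    using assms by (elim disjE) simp_all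
qed

lemma hexagonal_form_solutions:
  fixes a b c d :: int
  assumes "a\<^sup>2 - a * c + c\<^sup>2 = 1" "b\<^sup>2 - b * d + d\<^sup>2 = 1"
    and "(a + b)\<^sup>2 - (a + b) * (c + d) + (c + d)\<^sup>2 = 1"
  shows "(a, b, c, d) \<in> {(1, 0, 0, 1), (-1, 1, 0, 1), (0, 1, 1, 0), (1, -1, 1, 0),
                          (0, 1, -1, 1), (-1, 0, -1, 1), (1, 0, 1, -1), (0, -1, 1, -1),
                          (-1, 1, -1, 0), (0, -1, -1, 0), (1, -1, 0, -1), (-1, 0, 0, -1)}"
proof -
  have bound: "y\<^sup>2 \<le> 1" if "x\<^sup>2 - x * y + y\<^sup>2 = 1" for x y :: int
  proof -
    have "(2 * x - y)\<^sup>2 + 3 * y\<^sup>2 = 4"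
      using that by (simp add: power2_eq_square algebra_simps)
    then show ?thesis
      using zero_le_power2[of "2 * x - y"] by linarith
  qed
  have "a\<^sup>2 \<le> 1" "b\<^sup>2 \<le> 1" "c\<^sup>2 \<le> 1" "d\<^sup>2 \<le> 1"
    using bound[of c a] bound[of a c] bound[of d b] bound[of b d] assms(1,2)
    by (simp_all add: algebra_simps)
  then have "a = -1 \<or> a = 0 \<or> a = 1" "b = -1 \<or> b = 0 \<or> b = 1"
    "c = -1 \<or> c = 0 \<or> c = 1" "d = -1 \<or> d = 0 \<or> d = 1"
    by (simp_all add: int_square_le_1)
  then show ?thesis
    using assms by (elim disjE) simp_all
qed

lemma square_point_group_words:
  assumes "linmap X \<in> lattice_normalizer integer_lattice" "orthogonal_wrt (mat 1) X"
  shows "X \<in> matrix_words {Amat, Cmat}"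
proof -
  have "(*v) X ` integer_lattice = integer_lattice"
    using assms(1) by (simp add: lattice_normalizer_def)
  then obtain a b c d :: int
    where X: "X = vector [vector [of_int a, of_int b], vector [of_int c, of_int d]]"
    by (rule integral_matrix_cases)
  have norm_eq: "(norm (X *v v))\<^sup>2 = (norm v)\<^sup>2" for v
    using assms(2) by (simp add: orthogonal_wrt_def)
  have "real_of_int (a\<^sup>2 + c\<^sup>2) = real_of_int 1" "real_of_int (b\<^sup>2 + d\<^sup>2) = real_of_int 1"
    "real_of_int ((a + b)\<^sup>2 + (c + d)\<^sup>2) = real_of_int 2"
    using norm_eq[of e1] norm_eq[of e2] norm_eq[of "e1 + e2"] by (simp_all add: X norm2_sq mat2_mult_vector)
  then have "(a, b, c, d) \<in> {(1, 0, 0, 1), (-1, 0, 0, 1), (0, 1, 1, 0), (0, -1, 1, 0),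
                          (0, 1, -1, 0), (0, -1, -1, 0), (1, 0, 0, -1), (-1, 0, 0, -1)}"
    by (intro square_form_solutions) (simp_all only: of_int_eq_iff)
  then have "X \<in> {mat 1, Amat, Cmat, Amat ** Cmat, Cmat ** Amat, Amat ** Cmat ** Amat,
      Cmat ** Amat ** Cmat, Amat ** Cmat ** Amat ** Cmat}"
    by (auto simp: X Amat_def Cmat_def mat2_mult mat2_1)
  moreover have "{mat 1, Amat, Cmat, Amat ** Cmat, Cmat ** Amat, Amat ** Cmat ** Amat,
      Cmat ** Amat ** Cmat, Amat ** Cmat ** Amat ** Cmat} \<subseteq> matrix_words {Amat, Cmat}"
    by (simp add: matrix_words.mat_1 matrix_words_generator matrix_words_mult)
  ultimately show ?thesis
    by blast
qed

lemma hexagonal_point_group_words: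
  assumes "linmap X \<in> lattice_normalizer integer_lattice" "orthogonal_wrt Dmat X"
  shows "X \<in> matrix_words {Bmat, Cmat}"
proof -
  have "(*v) X ` integer_lattice = integer_lattice"
    using assms(1) by (simp add: lattice_normalizer_def)
  then obtain a b c d :: int
    where X: "X = vector [vector [of_int a, of_int b], vector [of_int c, of_int d]]"
    by (rule integral_matrix_cases)
  have form_eq: "((X *v v) $ 1)\<^sup>2 - (X *v v) $ 1 * (X *v v) $ 2 + ((X *v v) $ 2)\<^sup>2
      = (v $ 1)\<^sup>2 - v $ 1 * v $ 2 + (v $ 2)\<^sup>2" for v
    using assms(2) by (simp add: orthogonal_wrt_sq norm_Dmat_sq)
  have "real_of_int (a\<^sup>2 - a * c + c\<^sup>2) = real_of_int 1" "real_of_int (b\<^sup>2 - b * d + d\<^sup>2) = real_of_int 1"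
    "real_of_int ((a + b)\<^sup>2 - (a + b) * (c + d) + (c + d)\<^sup>2) = real_of_int 1"
    using form_eq[of e1] form_eq[of e2] form_eq[of "e1 + e2"] by (simp_all add: X mat2_mult_vector)
  then have "(a, b, c, d) \<in> {(1, 0, 0, 1), (-1, 1, 0, 1), (0, 1, 1, 0), (1, -1, 1, 0),
                          (0, 1, -1, 1), (-1, 0, -1, 1), (1, 0, 1, -1), (0, -1, 1, -1),
                          (-1, 1, -1, 0), (0, -1, -1, 0), (1, -1, 0, -1), (-1, 0, 0, -1)}"
    by (intro hexagonal_form_solutions) (simp_all only: of_int_eq_iff)
  then have "X \<in> {mat 1, Bmat, Cmat, Bmat ** Cmat, Cmat ** Bmat, Bmat ** Cmat ** Bmat,
      Cmat ** Bmat ** Cmat, Bmat ** Cmat ** Bmat ** Cmat, Cmat ** Bmat ** Cmat ** Bmat,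
      Bmat ** Cmat ** Bmat ** Cmat ** Bmat, Cmat ** Bmat ** Cmat ** Bmat ** Cmat,
      Bmat ** Cmat ** Bmat ** Cmat ** Bmat ** Cmat}"
    by (auto simp: X Bmat_def Cmat_def mat2_mult mat2_1)
  moreover have "{mat 1, Bmat, Cmat, Bmat ** Cmat, Cmat ** Bmat, Bmat ** Cmat ** Bmat,
      Cmat ** Bmat ** Cmat, Bmat ** Cmat ** Bmat ** Cmat, Cmat ** Bmat ** Cmat ** Bmat,
      Bmat ** Cmat ** Bmat ** Cmat ** Bmat, Cmat ** Bmat ** Cmat ** Bmat ** Cmat,
      Bmat ** Cmat ** Bmat ** Cmat ** Bmat ** Cmat} \<subseteq> matrix_words {Bmat, Cmat}"
    by (simp add: matrix_words.mat_1 matrix_words_generator matrix_words_mult)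
  ultimately show ?thesis
    by blast
qed

lemma generate_Kgrp_point_group:
  assumes "linmap X \<in> lattice_normalizer integer_lattice" "linmap Y \<in> lattice_normalizer integer_lattice"
    and "orthogonal_wrt Q X" "orthogonal_wrt Q Y"
    and "\<And>Z. linmap Z \<in> lattice_normalizer integer_lattice \<Longrightarrow> orthogonal_wrt Q Z
      \<Longrightarrow> Z \<in> matrix_words {X, Y}"
  shows "generate (AffOrb Mgrp) (Kgrp \<union> {induced Mgrp (linmap X), induced Mgrp (linmap Y)})
    = {induced Mgrp \<phi> | \<phi>. \<phi> \<in> lattice_normalizer integer_lattice \<and> orthogonal_wrt Q (snd \<phi>)}"
proof -
  have gens: "Kgrp \<union> {induced Mgrp (linmap X), induced Mgrp (linmap Y)}
      = induced Mgrp ` (range transl \<union> linmap ` {X, Y})"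
    by (auto simp: Kgrp_def)
  show ?thesis
    unfolding gens unfolding Mgrp_eq
    by (intro generate_AffOrb_transl_group[OF add_subgroup_integer_lattice
          orthogonal_wrt_mat_1 orthogonal_wrt_mult orthogonal_wrt_matrix_inv])
      (use assms in auto)
qed

lemma generators_in_lattice_normalizer:
  "linmap Amat \<in> lattice_normalizer integer_lattice"
  "linmap Bmat \<in> lattice_normalizer integer_lattice"
  "linmap Cmat \<in> lattice_normalizer integer_lattice"
  using involution_in_lattice_normalizer[of "-1" 0 0 1] involution_in_lattice_normalizer[of "-1" 1 0 1]
    involution_in_lattice_normalizer[of 0 1 1 0]
  by (simp_all add: Amat_def Bmat_def Cmat_def mat2_mult mat2_1)

lemma generators_orthogonal_wrt:
  "orthogonal_wrt (mat 1) Amat" "orthogonal_wrt (mat 1) Cmat"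
  "orthogonal_wrt Dmat Bmat" "orthogonal_wrt Dmat Cmat"
proof -
  have mult_vector: "Amat *v v = vector [- v $ 1, v $ 2]" "Bmat *v v = vector [v $ 2 - v $ 1, v $ 2]"
    "Cmat *v v = vector [v $ 2, v $ 1]" for v
    by (simp_all add: Amat_def Bmat_def Cmat_def mat2_mult_vector)
  show "orthogonal_wrt (mat 1) Amat" "orthogonal_wrt (mat 1) Cmat"
    by (simp_all only: orthogonal_wrt_sq mult_vector matrix_vector_mul_lid norm2_sq vector_2)
      (simp_all add: add.commute)
  show "orthogonal_wrt Dmat Bmat" "orthogonal_wrt Dmat Cmat"
    by (simp_all only: orthogonal_wrt_sq mult_vector norm_Dmat_sq vector_2)
      (simp_all add: power2_eq_square algebra_simps)
qed

lemma Sym_Mgrp: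
  "Sym Mgrp = generate (AffOrb Mgrp) (Kgrp \<union> {induced Mgrp (linmap Amat), induced Mgrp (linmap Cmat)})"
proof -
  have "Sym Mgrp = {induced Mgrp \<phi> | \<phi>.
      \<phi> \<in> lattice_normalizer integer_lattice \<and> orthogonal_wrt (mat 1) (snd \<phi>)}"
    unfolding Mgrp_eq orthogonal_wrt_mat_1_iff
    by (rule Sym_transl_group[OF add_subgroup_integer_lattice zero_less_one one_le_norm_integer_lattice])
  also have "\<dots> = generate (AffOrb Mgrp) (Kgrp \<union> {induced Mgrp (linmap Amat), induced Mgrp (linmap Cmat)})"
    by (rule generate_Kgrp_point_group[symmetric, OF generators_in_lattice_normalizer(1,3) _ _
          square_point_group_words])
      (simp_all add: generators_orthogonal_wrt)
  finally show ?thesis .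
qed

lemma Sym_Lgrp:
  "Sym Lgrp = sharp (linmap Dmat) Mgrp Lgrp `
     generate (AffOrb Mgrp) (Kgrp \<union> {induced Mgrp (linmap Bmat), induced Mgrp (linmap Cmat)})"
proof -
  have "Sym Lgrp = sharp (linmap Dmat) Mgrp Lgrp ` {induced Mgrp \<phi> | \<phi>.
      \<phi> \<in> lattice_normalizer integer_lattice \<and> orthogonal_wrt Dmat (snd \<phi>)}"
    using Sym_transl_group_image[OF add_subgroup_integer_lattice, of "linmap Dmat" 1]
    by (simp add: Mgrp_eq Lgrp_eq invertible_Dmat one_le_norm_hexagonal_lattice
        orthogonal_wrt_iff[OF invertible_Dmat])
  also have "{induced Mgrp \<phi> | \<phi>.
      \<phi> \<in> lattice_normalizer integer_lattice \<and> orthogonal_wrt Dmat (snd \<phi>)}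
    = generate (AffOrb Mgrp) (Kgrp \<union> {induced Mgrp (linmap Bmat), induced Mgrp (linmap Cmat)})"
    by (rule generate_Kgrp_point_group[symmetric, OF generators_in_lattice_normalizer(2,3) _ _
          hexagonal_point_group_words])
      (simp_all add: generators_orthogonal_wrt)
  finally show ?thesis .
qed

theorem lemma30:
  shows "Sym Mgrp = generate (AffOrb Mgrp)
            (Kgrp \<union> {induced Mgrp (linmap Amat), induced Mgrp (linmap Cmat)})
       \<and> conj_set (linmap Dmat) Mgrp = Lgrp
       \<and> (\<forall>\<phi> \<in> aff_normalizer Mgrp.
            sharp (linmap Dmat) Mgrp Lgrp (induced Mgrp \<phi>)
              = induced Lgrp (aff_comp (aff_comp (linmap Dmat) \<phi>) (aff_inv (linmap Dmat))))
       \<and> sharp (linmap Dmat) Mgrp Lgrp \<in> iso (AffOrb Mgrp) (AffOrb Lgrp)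
       \<and> Sym Lgrp = sharp (linmap Dmat) Mgrp Lgrp `
            generate (AffOrb Mgrp)
              (Kgrp \<union> {induced Mgrp (linmap Bmat), induced Mgrp (linmap Cmat)})"
proof -
  note L = add_subgroup_integer_lattice
  have D: "invertible (snd (linmap Dmat))"
    by (simp add: invertible_Dmat)
  have "conj_set (linmap Dmat) Mgrp = Lgrp"
    by (simp add: Mgrp_eq Lgrp_eq conj_set_transl_group invertible_Dmat)
  moreover have "\<forall>\<phi> \<in> aff_normalizer Mgrp. sharp (linmap Dmat) Mgrp Lgrp (induced Mgrp \<phi>)
      = induced Lgrp (aff_conj (linmap Dmat) \<phi>)"
    using sharp_induced[OF L D] by (simp add: Mgrp_eq Lgrp_eq aff_normalizer_transl_group)
  moreover have "sharp (linmap Dmat) Mgrp Lgrp \<in> iso (AffOrb Mgrp) (AffOrb Lgrp)"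
    using sharp_iso[OF L D] by (simp add: Mgrp_eq Lgrp_eq)
  ultimately show ?thesis
    using Sym_Mgrp Sym_Lgrp by blast
qed

end
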